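(* Let $(X,\mathcal{B})$ be a tree-like ball space. Then (1) $\operatorname{cir}(\mathcal{B})\le 1$; (2) $(X,\operatorname{ci}(\mathcal{B}))$ is tree-like; (3) $(X,\operatorname{ci}(\mathcal{B}))$ is spherically complete whenever $(X,\mathcal{B})$ is.
   Context: A ball space $(X,\mathcal{B})$ is a nonempty set $X$ with a nonempty collection $\mathcal{B}$ of nonempty subsets of $X$. A chain in $\mathcal{B}$ is a nonempty subset linearly ordered by inclusion; $(X,\mathcal{B})$ is spherically complete if every chain has nonempty intersection. For a nonempty family $\mathcal{B}$ of nonempty sets, $\operatorname{ci}(\mathcal{B})$ is the family of all nonempty sets $\bigcap\mathcal{C}$ with $\mathcal{C}\subseteq\mathcal{B}$ a chain. Define by transfinite recursion $\operatorname{ci}_0(\mathcal{B})=\mathcal{B}$ and $\operatorname{ci}_\alpha(\mathcal{B})=\operatorname{ci}\big(\bigcup_{\xi<\alpha}\operatorname{ci}_\xi(\mathcal{B})\big)$ for $\alpha>0$; the chain intersection rank $\operatorname{cir}(\mathcal{B})$ is the least ordinal $\alpha$ with $\operatorname{ci}_{\alpha+1}(\mathcal{B})=\operatorname{ci}_\alpha(\mathcal{B})$. $(X,\mathcal{B})$ is tree-like if for all $B_1,B_2\in\mathcal{B}$, $B_1\cap B_2\ne\emptyset$ implies $B_1\subseteq B_2$ or $B_2\subseteq B_1$. *)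

theory Defs
  imports Main
begin

text \<open>
  HOL has no type of all ordinals. The type \<open>'a ordinal\<close> is the initial segment of the
  ordinals below the successor cardinal of \<open>max \<aleph>\<^sub>0 (2 ^ |'a|)\<close>, that is, it consists of all
  ordinals of cardinality at most \<open>max \<aleph>\<^sub>0 (2 ^ |'a|)\<close>. It is closed under successors, and it is
  long enough to contain the chain intersection rank of every family of nonempty
  subsets of \<open>'a\<close>; the latter is the lemma \<open>cir_exists\<close> below.
\<close>

definition ordinal_rel :: "(nat + 'a set) set rel" where
  "ordinal_rel = cardSuc (card_of (UNIV :: (nat + 'a set) set))"

lemma card_order_ordinal_rel: "Card_order ordinal_rel"
  unfolding ordinal_rel_def by (intro cardSuc_Card_order card_of_Card_order)

lemma well_order_ordinal_rel: "Well_order ordinal_rel"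
  using card_order_ordinal_rel card_order_on_well_order_on by blast

lemma infinite_ordinal_rel: "infinite (Field (ordinal_rel :: (nat + 'a set) set rel))"
  by (simp add: ordinal_rel_def card_of_cardSuc_finite)

typedef 'a ordinal = "Field (ordinal_rel :: (nat + 'a set) set rel)"
  using infinite_ordinal_rel by (metis finite.emptyI ex_in_conv)

instantiation ordinal :: (type) wellorder
begin

definition less_eq_ordinal :: "'a ordinal \<Rightarrow> 'a ordinal \<Rightarrow> bool" where
  "(\<alpha> :: 'a ordinal) \<le> \<beta> \<longleftrightarrow> (Rep_ordinal \<alpha>, Rep_ordinal \<beta>) \<in> ordinal_rel"

definition less_ordinal :: "'a ordinal \<Rightarrow> 'a ordinal \<Rightarrow> bool" where
  "(\<alpha> :: 'a ordinal) < \<beta> \<longleftrightarrow> \<alpha> \<le> \<beta> \<and> \<alpha> \<noteq> \<beta>"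

instance
proof
  have wo: "Refl (ordinal_rel :: (nat + 'a set) set rel)"
    "trans (ordinal_rel :: (nat + 'a set) set rel)"
    "antisym (ordinal_rel :: (nat + 'a set) set rel)"
    "Total (ordinal_rel :: (nat + 'a set) set rel)"
    "wf ((ordinal_rel :: (nat + 'a set) set rel) - Id)"
    using well_order_ordinal_rel[where 'a = 'a]
    by (auto simp: well_order_on_def linear_order_on_def partial_order_on_def preorder_on_def)
  fix x y z :: "'a ordinal" and P :: "'a ordinal \<Rightarrow> bool"
  show refl: "x \<le> x"
    using wo(1) Rep_ordinal[of x] by (simp add: less_eq_ordinal_def refl_on_def)
  show antisym: "x = y" if "x \<le> y" "y \<le> x" for x y :: "'a ordinal"
    using antisymD[OF wo(3), of "Rep_ordinal x" "Rep_ordinal y"] that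
    by (simp add: less_eq_ordinal_def Rep_ordinal_inject)
  show "x < y \<longleftrightarrow> x \<le> y \<and> \<not> y \<le> x"
    using refl antisym[of x y] by (auto simp: less_ordinal_def)
  show "x \<le> z" if "x \<le> y" "y \<le> z"
    using transD[OF wo(2)] that unfolding less_eq_ordinal_def by blast
  show "x \<le> y \<or> y \<le> x"
    using wo(4) refl Rep_ordinal[of x] Rep_ordinal[of y]
    by (cases "x = y") (auto simp: less_eq_ordinal_def total_on_def Rep_ordinal_inject)
  show "P x" if step: "\<And>x. (\<And>y. y < x \<Longrightarrow> P y) \<Longrightarrow> P x"
  proof -
    have "wf (inv_image ((ordinal_rel :: (nat + 'a set) set rel) - Id) Rep_ordinal)"
      using wo(5) by (rule wf_inv_image)
    then show ?thesis
    proof (induction x rule: wf_induct_rule)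
      case (less x)
      show ?case
      proof (rule step)
        fix y assume "y < x"
        then have "(y, x) \<in> inv_image (ordinal_rel - Id) Rep_ordinal"
          by (simp add: less_ordinal_def less_eq_ordinal_def Rep_ordinal_inject)
        then show "P y"
          by (rule less)
      qed
    qed
  qed
qed

end

definition osucc :: "'a ordinal \<Rightarrow> 'a ordinal" where
  "osucc \<alpha> = (LEAST \<beta>. \<alpha> < \<beta>)"

instantiation ordinal :: (type) "{zero, one}"
begin

definition zero_ordinal :: "'a ordinal" where
  "(0 :: 'a ordinal) = (LEAST \<alpha>. True)"

definition one_ordinal :: "'a ordinal" where
  "(1 :: 'a ordinal) = osucc 0"

instance ..

end

lemma zero_le_ordinal [simp]: "0 \<le> (\<alpha> :: 'a ordinal)"
  by (simp add: zero_ordinal_def Least_le)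

lemma ordinal_unbounded: "\<exists>\<beta>. \<alpha> < (\<beta> :: 'a ordinal)"
proof (rule ccontr)
  assume "\<nexists>\<beta>. \<alpha> < \<beta>"
  then have "\<beta> \<le> \<alpha>" for \<beta>
    by (simp add: not_less)
  then have "Field ordinal_rel = under ordinal_rel (Rep_ordinal \<alpha>)"
    unfolding under_def less_eq_ordinal_def
    by (auto intro: FieldI1) (metis Rep_ordinal_cases)
  then show False
    using Card_order_infinite_not_under[OF card_order_ordinal_rel infinite_ordinal_rel] by blast
qed

lemma osucc_greater: "\<alpha> < osucc \<alpha>"
  unfolding osucc_def by (rule LeastI_ex[OF ordinal_unbounded])

lemma osucc_le_iff: "osucc \<alpha> \<le> \<beta> \<longleftrightarrow> \<alpha> < \<beta>"
  using osucc_greater less_le_trans Least_le unfolding osucc_def by metis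

definition ball_space :: "'a set \<Rightarrow> 'a set set \<Rightarrow> bool" where
  "ball_space X \<B> \<longleftrightarrow> X \<noteq> {} \<and> \<B> \<noteq> {} \<and> (\<forall>B\<in>\<B>. B \<noteq> {} \<and> B \<subseteq> X)"

definition ball_chain :: "'a set set \<Rightarrow> 'a set set \<Rightarrow> bool" where
  "ball_chain \<B> \<C> \<longleftrightarrow> \<C> \<noteq> {} \<and> subset.chain \<B> \<C>"

definition spherically_complete :: "'a set \<Rightarrow> 'a set set \<Rightarrow> bool" where
  "spherically_complete X \<B> \<longleftrightarrow>
     ball_space X \<B> \<and> (\<forall>\<C>. ball_chain \<B> \<C> \<longrightarrow> \<Inter>\<C> \<noteq> {})"

definition tree_like :: "'a set \<Rightarrow> 'a set set \<Rightarrow> bool" where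
  "tree_like X \<B> \<longleftrightarrow>
     ball_space X \<B> \<and>
     (\<forall>B\<^sub>1\<in>\<B>. \<forall>B\<^sub>2\<in>\<B>. B\<^sub>1 \<inter> B\<^sub>2 \<noteq> {} \<longrightarrow> B\<^sub>1 \<subseteq> B\<^sub>2 \<or> B\<^sub>2 \<subseteq> B\<^sub>1)"

definition ci :: "'a set set \<Rightarrow> 'a set set" where
  "ci \<B> = {\<Inter>\<C> |\<C>. ball_chain \<B> \<C> \<and> \<Inter>\<C> \<noteq> {}}"

function ci_iter :: "'a ordinal \<Rightarrow> 'a set set \<Rightarrow> 'a set set" where
  "ci_iter \<alpha> \<B> = (if \<alpha> = 0 then \<B> else ci (\<Union>\<xi>\<in>{\<xi>. \<xi> < \<alpha>}. ci_iter \<xi> \<B>))"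
  by auto
termination
  by (relation "inv_image {(\<xi>, \<alpha>). \<xi> < \<alpha>} fst") (auto intro: wf_inv_image wf)

declare ci_iter.simps [simp del]

definition cir :: "'a set set \<Rightarrow> 'a ordinal" where
  "cir \<B> = (LEAST \<alpha>. ci_iter (osucc \<alpha>) \<B> = ci_iter \<alpha> \<B>)"

lemma ci_iter_mono:
  assumes "{} \<notin> \<B>" and "\<alpha> \<le> \<beta>"
  shows "ci_iter \<alpha> \<B> \<subseteq> ci_iter \<beta> \<B>"
proof (cases "\<alpha> = \<beta>")
  case False
  then have less: "\<alpha> < \<beta>" and "\<beta> \<noteq> 0"
    using assms(2) order_antisym[OF zero_le_ordinal[of \<alpha>]] by (auto simp: less_le)
  show ?thesis
  proof
    fix S assume S: "S \<in> ci_iter \<alpha> \<B>"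
    then have "S \<noteq> {}"
      using assms(1) by (subst (asm) ci_iter.simps) (auto simp: ci_def split: if_splits)
    moreover have "ball_chain (\<Union>\<xi>\<in>{\<xi>. \<xi> < \<beta>}. ci_iter \<xi> \<B>) {S}"
      using S less by (auto simp: ball_chain_def subset_chain_def)
    ultimately have "S \<in> ci (\<Union>\<xi>\<in>{\<xi>. \<xi> < \<beta>}. ci_iter \<xi> \<B>)"
      unfolding ci_def by (intro CollectI exI[of _ "{S}"]) simp
    then show "S \<in> ci_iter \<beta> \<B>"
      using \<open>\<beta> \<noteq> 0\<close> by (subst ci_iter.simps) simp
  qed
qed simp

text \<open>The sequence becomes stationary within \<open>'a ordinal\<close>, so \<open>cir\<close> is the true rank.\<close>

lemma cir_exists:
  fixes \<B> :: "'a set set"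
  assumes "{} \<notin> \<B>"
  shows "\<exists>\<alpha>. ci_iter (osucc \<alpha>) \<B> = ci_iter \<alpha> \<B>"
proof (rule ccontr)
  assume "\<nexists>\<alpha>. ci_iter (osucc \<alpha>) \<B> = ci_iter \<alpha> \<B>"
  moreover have "ci_iter \<alpha> \<B> \<subseteq> ci_iter (osucc \<alpha>) \<B>" for \<alpha>
    by (rule ci_iter_mono[OF assms]) (simp add: osucc_greater less_imp_le)
  ultimately have "\<exists>S. S \<in> ci_iter (osucc \<alpha>) \<B> - ci_iter \<alpha> \<B>" for \<alpha>
    by blast
  then obtain f where f: "\<And>\<alpha>. f \<alpha> \<in> ci_iter (osucc \<alpha>) \<B> - ci_iter \<alpha> \<B>"
    by metis
  have neq: "f \<alpha> \<noteq> f \<beta>" if "\<alpha> < \<beta>" for \<alpha> \<beta>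
    using f[of \<alpha>] f[of \<beta>] ci_iter_mono[OF assms, of "osucc \<alpha>" \<beta>] that osucc_le_iff[of \<alpha> \<beta>]
    by auto
  have "inj f"
    by (rule injI) (metis neq linorder_neqE)
  let ?F = "Field (ordinal_rel :: (nat + 'a set) set rel)"
  have "inj_on (\<lambda>x. Inr (f (Abs_ordinal x)) :: nat + 'a set) ?F"
    using \<open>inj f\<close> by (intro inj_onI) (simp only: sum.inject inj_eq Abs_ordinal_inject)
  then have "ordLeq3 (card_of ?F) (card_of (UNIV :: (nat + 'a set) set))"
    by (meson card_of_ordLeq subset_UNIV)
  moreover have "ordIso2 (card_of ?F) (ordinal_rel :: (nat + 'a set) set rel)"
    by (rule card_of_Field_ordIso[OF card_order_ordinal_rel])
  moreover have "ordLess2 (card_of (UNIV :: (nat + 'a set) set)) (ordinal_rel :: (nat + 'a set) set rel)"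
    unfolding ordinal_rel_def by (rule cardSuc_greater[OF card_of_Card_order])
  ultimately show False
    by (meson not_ordLess_ordLeq ordLess_ordIso_trans ordIso_symmetric)
qed

end

theory Submission
  imports Defs
begin

text \<open>
  In a tree-like space, balls that share a point are comparable. Given a chain of nonempty
  intersections of chains of balls, any two balls occurring in these chains contain the smaller of
  two of the intersections, so all these balls together form a single chain with the same
  intersection. Hence \<open>ci (ci \<B>) = ci \<B>\<close>, and spherical completeness passes to \<open>ci \<B>\<close>.
\<close>

lemma tree_like_comparable:
  assumes "tree_like X \<B>" "A \<in> \<B>" "B \<in> \<B>" "x \<in> A" "x \<in> B"
  shows "A \<subseteq> B \<or> B \<subseteq> A"
  using assms unfolding tree_like_def by blast

lemma ball_chain_subset: "ball_chain \<B> \<C> \<Longrightarrow> \<C> \<subseteq> \<B>"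
  by (simp add: ball_chain_def subset_chain_def)

lemma ciE:
  assumes "S \<in> ci \<B>"
  obtains \<C> where "ball_chain \<B> \<C>" "S = \<Inter>\<C>" "S \<noteq> {}"
  using assms unfolding ci_def by blast

text \<open>Each ball is the intersection of the chain whose only member is itself, and
  \<open>ci\<close> keeps it because it is nonempty.\<close>

lemma subset_ci:
  assumes "{} \<notin> \<B>"
  shows "\<B> \<subseteq> ci \<B>"
proof
  fix S assume "S \<in> \<B>"
  then have "ball_chain \<B> {S}" "\<Inter>{S} \<noteq> {}"
    using assms by (auto simp: ball_chain_def subset_chain_def)
  then show "S \<in> ci \<B>"
    unfolding ci_def by (intro CollectI exI[of _ "{S}"]) simp
qed

lemma ball_space_ci:
  assumes "ball_space X \<B>"
  shows "ball_space X (ci \<B>)"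
proof -
  have "{} \<notin> \<B>"
    using assms by (auto simp: ball_space_def)
  then have "ci \<B> \<noteq> {}"
    using assms subset_ci[of \<B>] by (auto simp: ball_space_def)
  moreover have "S \<noteq> {} \<and> S \<subseteq> X" if S: "S \<in> ci \<B>" for S
  proof -
    from S obtain \<C> where \<C>: "ball_chain \<B> \<C>" "S = \<Inter>\<C>" "S \<noteq> {}"
      by (rule ciE)
    \<comment> \<open>Chains are nonempty, so \<open>\<Inter>\<C>\<close> lies inside a ball; the
      intersection of an empty family would be \<open>UNIV\<close>.\<close>
    then obtain B where "B \<in> \<C>"
      by (auto simp: ball_chain_def)
    moreover from this have "B \<subseteq> X"
      using assms ball_chain_subset[OF \<C>(1)] by (auto simp: ball_space_def)
    ultimately show ?thesis
      using \<C> by blast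
  qed
  ultimately show ?thesis
    using assms by (simp add: ball_space_def)
qed

text \<open>A common point of \<open>S\<close> and \<open>T\<close> lies in every ball of both
  chains, so each ball of one chain is comparable with each ball of the other.\<close>

lemma tree_like_ci:
  assumes "tree_like X \<B>"
  shows "tree_like X (ci \<B>)"
proof -
  have "S \<subseteq> T \<or> T \<subseteq> S" if ST: "S \<in> ci \<B>" "T \<in> ci \<B>" "S \<inter> T \<noteq> {}" for S T
  proof -
    obtain \<C> where \<C>: "ball_chain \<B> \<C>" "S = \<Inter>\<C>"
      using ST(1) by (rule ciE)
    obtain \<D> where \<D>: "ball_chain \<B> \<D>" "T = \<Inter>\<D>"
      using ST(2) by (rule ciE)
    obtain x where x: "x \<in> S" "x \<in> T"
      using ST(3) by blast
    have "A \<subseteq> B \<or> B \<subseteq> A" if "A \<in> \<C>" "B \<in> \<D>" for A B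
    proof (rule tree_like_comparable[OF assms])
      show "A \<in> \<B>" "B \<in> \<B>"
        using that ball_chain_subset[OF \<C>(1)] ball_chain_subset[OF \<D>(1)] by auto
      show "x \<in> A" "x \<in> B"
        using that x \<C>(2) \<D>(2) by auto
    qed
    \<comment> \<open>If every \<open>B\<close> in \<open>\<D>\<close> contains some
      \<open>A\<close> in \<open>\<C>\<close>, then \<open>S\<close> lies in \<open>T\<close>.
      Otherwise some \<open>B\<close> lies in every \<open>A\<close>, and then \<open>T\<close> lies
      in \<open>S\<close>.\<close>
    then show ?thesis
      unfolding \<C>(2) \<D>(2) by blast
  qed
  moreover have "ball_space X (ci \<B>)"
    using assms by (simp add: tree_like_def ball_space_ci)
  ultimately show ?thesis
    by (simp add: tree_like_def)
qed

text \<open>Comparing two balls takes a point from only two members of \<open>\<D>\<close>, so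
  chains with empty intersection are covered too, as the transfer of spherical completeness
  requires.\<close>

lemma ball_chain_ci_flatten:
  assumes "tree_like X \<B>" and "ball_chain (ci \<B>) \<D>"
  obtains \<E> where "ball_chain \<B> \<E>" "\<Inter>\<E> = \<Inter>\<D>"
proof -
  have "\<exists>\<C>. ball_chain \<B> \<C> \<and> \<Inter>\<C> = D \<and> D \<noteq> {}" if D: "D \<in> \<D>" for D
  proof -
    have "D \<in> ci \<B>"
      using D ball_chain_subset[OF assms(2)] by (rule subsetD[rotated])
    then obtain \<C> where "ball_chain \<B> \<C>" "D = \<Inter>\<C>" "D \<noteq> {}"
      by (rule ciE)
    then show ?thesis
      by (intro exI[of _ \<C>]) simp
  qed
  then obtain c where c: "\<And>D. D \<in> \<D> \<Longrightarrow> ball_chain \<B> (c D) \<and> \<Inter>(c D) = D \<and> D \<noteq> {}"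
    by metis
  define \<E> where "\<E> = (\<Union>D\<in>\<D>. c D)"
  have sub: "\<E> \<subseteq> \<B>"
    using c by (auto simp: \<E>_def dest!: ball_chain_subset)
  obtain D\<^sub>0 where "D\<^sub>0 \<in> \<D>"
    using assms(2) by (auto simp: ball_chain_def)
  moreover from this have "c D\<^sub>0 \<noteq> {}"
    using c by (simp add: ball_chain_def)
  ultimately have "\<E> \<noteq> {}"
    unfolding \<E>_def by blast
  moreover have "A \<subseteq> B \<or> B \<subseteq> A" if AB: "A \<in> \<E>" "B \<in> \<E>" for A B
  proof -
    obtain D E where D: "D \<in> \<D>" "A \<in> c D" and E: "E \<in> \<D>" "B \<in> c E"
      using AB unfolding \<E>_def by blast
    have "D \<subseteq> E \<or> E \<subseteq> D"
      using assms(2) D(1) E(1) by (auto simp: ball_chain_def subset_chain_def)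
    moreover have "D \<noteq> {}" "E \<noteq> {}" "D \<subseteq> A" "E \<subseteq> B"
      using c[OF D(1)] c[OF E(1)] D(2) E(2) by auto
    \<comment> \<open>Any point of the smaller of \<open>D\<close> and \<open>E\<close> will
      do.\<close>
    ultimately obtain x where "x \<in> A" "x \<in> B"
      by blast
    then show ?thesis
      using tree_like_comparable[OF assms(1)] AB sub by blast
  qed
  ultimately have "ball_chain \<B> \<E>"
    using sub by (auto simp: ball_chain_def subset_chain_def)
  moreover have "\<Inter>\<E> = (\<Inter>D\<in>\<D>. \<Inter>(c D))"
    unfolding \<E>_def by blast
  then have "\<Inter>\<E> = \<Inter>\<D>"
    using c by simp
  ultimately show ?thesis
    by (rule that)
qed

lemma ci_ci_tree_like:
  assumes "tree_like X \<B>"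
  shows "ci (ci \<B>) = ci \<B>"
proof
  show "ci (ci \<B>) \<subseteq> ci \<B>"
  proof
    fix S assume "S \<in> ci (ci \<B>)"
    then obtain \<D> where \<D>: "ball_chain (ci \<B>) \<D>" "S = \<Inter>\<D>" "S \<noteq> {}"
      by (rule ciE)
    obtain \<E> where "ball_chain \<B> \<E>" "\<Inter>\<E> = \<Inter>\<D>"
      using ball_chain_ci_flatten[OF assms \<D>(1)] .
    then show "S \<in> ci \<B>"
      using \<D>(2,3) unfolding ci_def by (intro CollectI exI[of _ \<E>] conjI) simp_all
  qed
  \<comment> \<open>Empty intersections are discarded by \<open>ci\<close>, so
    \<open>subset_ci\<close> applies to \<open>ci \<B>\<close> itself.\<close>
  show "ci \<B> \<subseteq> ci (ci \<B>)"
    by (rule subset_ci) (auto simp: ci_def)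
qed

lemma spherically_complete_ci:
  assumes "tree_like X \<B>" and "spherically_complete X \<B>"
  shows "spherically_complete X (ci \<B>)"
  unfolding spherically_complete_def
proof (intro conjI allI impI)
  show "ball_space X (ci \<B>)"
    using assms(1) by (simp add: tree_like_def ball_space_ci)
  fix \<D> assume "ball_chain (ci \<B>) \<D>"
  then obtain \<E> where "ball_chain \<B> \<E>" "\<Inter>\<E> = \<Inter>\<D>"
    using ball_chain_ci_flatten[OF assms(1)] by blast
  then show "\<Inter>\<D> \<noteq> {}"
    using assms(2) by (metis spherically_complete_def)
qed

lemma less_osucc_iff: "\<xi> < osucc \<alpha> \<longleftrightarrow> \<xi> \<le> \<alpha>"
  by (meson osucc_le_iff not_le)

lemma ci_iter_0: "ci_iter 0 \<B> = \<B>"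
  by (simp add: ci_iter.simps)

text \<open>The stages increase, so the union of all stages up to \<alpha> is the last of
  them.\<close>

lemma ci_iter_osucc:
  assumes "{} \<notin> \<B>"
  shows "ci_iter (osucc \<alpha>) \<B> = ci (ci_iter \<alpha> \<B>)"
proof -
  have "osucc \<alpha> \<noteq> 0"
    using osucc_greater[of \<alpha>] zero_le_ordinal[of \<alpha>] by (metis not_le)
  moreover have "(\<Union>\<xi>\<in>{\<xi>. \<xi> < osucc \<alpha>}. ci_iter \<xi> \<B>) = ci_iter \<alpha> \<B>"
    using ci_iter_mono[OF assms, of _ \<alpha>] by (auto simp: less_osucc_iff)
  ultimately show ?thesis
    by (subst ci_iter.simps) simp
qed

lemma cir_le_1_tree_like:
  assumes "tree_like X \<B>"
  shows "cir \<B> \<le> 1"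
proof -
  have "{} \<notin> \<B>"
    using assms by (auto simp: tree_like_def ball_space_def)
  \<comment> \<open>Stage 1 is \<open>ci \<B>\<close> and the next is \<open>ci (ci \<B>)\<close>,
    so idempotence makes 1 a candidate for the least index in \<open>cir\<close>.\<close>
  then have "ci_iter (osucc 1) \<B> = ci_iter 1 \<B>"
    by (simp add: one_ordinal_def ci_iter_osucc ci_iter_0 ci_ci_tree_like[OF assms])
  then show ?thesis
    unfolding cir_def by (rule Least_le)
qed

theorem theorem2p2:
  fixes X :: "'a set" and \<B> :: "'a set set"
  assumes "ball_space X \<B>" and "tree_like X \<B>"
  shows "cir \<B> \<le> 1 \<and>
         tree_like X (ci \<B>) \<and>
         (spherically_complete X \<B> \<longrightarrow> spherically_complete X (ci \<B>))"
  by (intro conjI impI cir_le_1_tree_like[OF assms(2)] tree_like_ci[OF assms(2)]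
      spherically_complete_ci[OF assms(2)])

end
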